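(* Let $(x_0,v_0),(x_1,v_1)\in\mathcal H=\{(x,v)\in\mathbb R^2:v\ge0\}$ with $x_0\ne x_1$, and suppose that at least one of the two points is not on the boundary (i.e. $v_0>0$ or $v_1>0$). Then the equation $$\frac{(v_1+v_0)(\delta-\sin\delta)-2\sqrt{v_1v_0}\left(\delta\cos\frac{\delta}{2}-2\sin\frac{\delta}{2}\right)}{2\sin^2\frac{\delta}{2}}=x_1-x_0$$ has a unique solution $\delta=\hat\delta$ with $-2\pi<\hat\delta<2\pi$, and $$d_H((x_0,v_0),(x_1,v_1))=\frac{\hat\delta}{\sin\frac{\hat\delta}{2}}\sqrt{v_1+v_0-2\sqrt{v_1v_0}\cos\frac{\hat\delta}{2}}.$$
   Context: The Heston distance $d_H$: on the open half-plane $\mathcal H^\circ=\{(x,v)\in\mathbb R^2:v>0\}$ consider the Riemannian metric $ds^2=v^{-1}(dx^2+dv^2)$; $d_H$ is the associated Riemannian distance (infimum of lengths of piecewise $C^1$ curves in $\mathcal H^\circ$), extended by continuity to the closed half-plane $\mathcal H$. The left-hand side of the equation for $\delta$ is assigned its limiting value $0$ at $\delta=0$. *)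

theory Defs
  imports "HOL-Analysis.Analysis"
begin

definition open_half_plane :: "(real \<times> real) set" where
  "open_half_plane = {(x, v). v > 0}"

definition closed_half_plane :: "(real \<times> real) set" where
  "closed_half_plane = {(x, v). v \<ge> 0}"

text \<open>The quadratic form \<open>ds\<^sup>2 = v\<^sup>-\<^sup>1 (dx\<^sup>2 + dv\<^sup>2)\<close> at the point \<open>p\<close>, applied to the tangent vector \<open>u\<close>.\<close>

definition heston_metric :: "real \<times> real \<Rightarrow> real \<times> real \<Rightarrow> real" where
  "heston_metric p u = ((fst u)\<^sup>2 + (snd u)\<^sup>2) / snd p"

text \<open>\<open>P\<close> is the set of break points: on every closed interval without break points in its
  interior the curve is \<open>C\<^sup>1\<close> up to and including the end points.  This is stronger than
  \<^const>\<open>valid_path\<close>, which does not require one-sided derivatives at the break points, so that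
  the speed of a valid path need not be integrable; here it always is.\<close>

definition piecewise_C1_curve :: "(real \<Rightarrow> real \<times> real) \<Rightarrow> bool" where
  "piecewise_C1_curve \<gamma> \<longleftrightarrow> path \<gamma> \<and>
     (\<exists>P. finite P \<and>
        (\<forall>a b. 0 \<le> a \<and> a < b \<and> b \<le> 1 \<and> P \<inter> {a<..<b} = {} \<longrightarrow>
           (\<exists>D. continuous_on {a..b} D \<and>
                (\<forall>t\<in>{a..b}. (\<gamma> has_vector_derivative D t) (at t within {a..b})))))"

definition heston_length :: "(real \<Rightarrow> real \<times> real) \<Rightarrow> real" where
  "heston_length \<gamma> =
     integral {0..1} (\<lambda>t. sqrt (heston_metric (\<gamma> t) (vector_derivative \<gamma> (at t))))"

definition heston_dist_interior :: "real \<times> real \<Rightarrow> real \<times> real \<Rightarrow> real" where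
  "heston_dist_interior p q =
     Inf {heston_length \<gamma> |\<gamma>. piecewise_C1_curve \<gamma> \<and> path_image \<gamma> \<subseteq> open_half_plane \<and>
                              pathstart \<gamma> = p \<and> pathfinish \<gamma> = q}"

definition heston_dist :: "real \<times> real \<Rightarrow> real \<times> real \<Rightarrow> real" where
  "heston_dist p q =
     (if p \<in> open_half_plane \<and> q \<in> open_half_plane then heston_dist_interior p q
      else Lim (at (p, q) within open_half_plane \<times> open_half_plane)
               (\<lambda>(p', q'). heston_dist_interior p' q'))"

text \<open>For \<open>\<bar>\<delta>\<bar> < 2 * pi\<close> the denominator vanishes only at \<open>\<delta> = 0\<close>, where the quotient has limit 0.\<close>

definition delta_lhs :: "real \<Rightarrow> real \<Rightarrow> real \<Rightarrow> real" where
  "delta_lhs v0 v1 \<delta> =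
     (if \<delta> = 0 then 0
      else ((v1 + v0) * (\<delta> - sin \<delta>)
              - 2 * sqrt (v1 * v0) * (\<delta> * cos (\<delta> / 2) - 2 * sin (\<delta> / 2)))
           / (2 * (sin (\<delta> / 2))\<^sup>2))"

end

theory Submission
  imports Defs "HOL-Real_Asymp.Real_Asymp"
begin

text \<open>
  Put \<open>r = sqrt v\<close> and \<open>p = \<delta> / 2\<close>.  The energy of a curve is four times the integral of
  \<open>r'\<^sup>2 + x'\<^sup>2 / (4 r\<^sup>2)\<close>, and \<open>x'\<^sup>2 / (4 r\<^sup>2) \<ge> p x' - p\<^sup>2 r\<^sup>2\<close>; hence it is bounded below by
  \<open>4 p (x\<^sub>1 - x\<^sub>0)\<close> plus four times the minimal action of a harmonic oscillator of frequency \<open>p\<close>,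
  which has no conjugate points on the unit time interval since \<open>\<bar>p\<bar> < pi\<close>.  If \<open>\<rho>\<close> is the extremal of
  the oscillator from \<open>sqrt v\<^sub>0\<close> to \<open>sqrt v\<^sub>1\<close>, then \<open>v w\<close> with \<open>w = \<rho>' / \<rho>\<close> solves the
  Hamilton-Jacobi equation and is a calibration for the whole open half-plane.  Equality holds along
  \<open>v = \<rho>\<^sup>2\<close>, \<open>x' = 2 p \<rho>\<^sup>2\<close>, and this curve has the right end point exactly when \<open>\<delta>\<close> solves the given
  equation.  The left-hand side of that equation is strictly increasing in \<open>\<delta>\<close>, so the solution
  depends continuously on the two points, which gives the formula on the boundary.
\<close>

section \<open>Lower bound for the length by a calibration\<close>

text \<open>Cutting at an interior break point leaves fewer break points inside each half, so
  \<open>Q\<close> is assembled from smooth pieces. It serves both the integrability of the speed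
  and the monotonicity of the calibration along a curve.\<close>

lemma breakpoint_induct:
  fixes a b :: real
  assumes "finite P" "a < b"
    and base: "\<And>c d. a \<le> c \<Longrightarrow> c < d \<Longrightarrow> d \<le> b \<Longrightarrow> P \<inter> {c<..<d} = {} \<Longrightarrow> Q c d"
    and trans: "\<And>c d e. a \<le> c \<Longrightarrow> c < d \<Longrightarrow> d < e \<Longrightarrow> e \<le> b \<Longrightarrow> Q c d \<Longrightarrow> Q d e \<Longrightarrow> Q c e"
  shows "Q a b"
proof -
  have "Q c d" if "a \<le> c" "c < d" "d \<le> b" for c d
    using that
  proof (induction "card (P \<inter> {c<..<d})" arbitrary: c d rule: less_induct)
    case less
    show ?case
    proof (cases "P \<inter> {c<..<d} = {}")
      case True
      then show ?thesis using base less.prems by blast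
    next
      case False
      then obtain m where m: "m \<in> P" "c < m" "m < d" by auto
      have "card (P \<inter> {c<..<m}) < card (P \<inter> {c<..<d})" "card (P \<inter> {m<..<d}) < card (P \<inter> {c<..<d})"
        using m \<open>finite P\<close> by (auto intro!: psubset_card_mono)
      then have "Q c m" "Q m d"
        using less.hyps less.prems m by auto
      then show ?thesis using trans m less.prems by blast
    qed
  qed
  then show ?thesis using \<open>a < b\<close> by blast
qed

text \<open>The pointwise calibration inequality. \<open>B\<close> is twice the dual norm of the
  covector \<open>(p, w)\<close>, so Cauchy-Schwarz bounds the left-hand side by
  \<open>2 * B * F\<close>; then \<open>2 * B \<le> B\<^sup>2 / L + L\<close>. \<open>F\<close> need
  only dominate the speed, which leaves room for a small increment.\<close>

lemma heston_cauchy_schwarz: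
  fixes p w v x' v' F L :: real
  assumes "v > 0" "L > 0" and F: "sqrt ((x'\<^sup>2 + v'\<^sup>2) / v) \<le> F"
  shows "4 * (p * x' + w * v') \<le> F * (4 * v * (p\<^sup>2 + w\<^sup>2) / L + L)"
proof -
  define B where "B = 2 * sqrt ((p\<^sup>2 + w\<^sup>2) * v)"
  have F0: "F \<ge> 0"
    using F \<open>v > 0\<close> by (meson order_trans real_sqrt_ge_zero divide_nonneg_pos sum_power2_ge_zero)
  have B2: "B\<^sup>2 = 4 * v * (p\<^sup>2 + w\<^sup>2)"
    using \<open>v > 0\<close> by (simp add: B_def power_mult_distrib)
  have "p * x' + w * v' \<le> sqrt (p\<^sup>2 + w\<^sup>2) * sqrt (x'\<^sup>2 + v'\<^sup>2)"
  proof -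
    have "(p * x' + w * v')\<^sup>2 \<le> (p\<^sup>2 + w\<^sup>2) * (x'\<^sup>2 + v'\<^sup>2)"
      using zero_le_power2[of "p * v' - w * x'"] by (simp add: power2_eq_square algebra_simps)
    then show ?thesis
      by (metis real_sqrt_mult real_le_rsqrt)
  qed
  also have "\<dots> = B / 2 * sqrt ((x'\<^sup>2 + v'\<^sup>2) / v)"
    using \<open>v > 0\<close> by (simp add: B_def real_sqrt_mult real_sqrt_divide)
  also have "\<dots> \<le> B / 2 * F"
    using F \<open>v > 0\<close> by (intro mult_left_mono) (auto simp: B_def)
  finally have "4 * (p * x' + w * v') \<le> F * (2 * B)" by (simp add: algebra_simps)
  also have "\<dots> \<le> F * (B\<^sup>2 / L + L)"
  proof (rule mult_left_mono[OF _ F0])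
    have "2 * B * L \<le> B\<^sup>2 + L * L"
      using zero_le_power2[of "B - L"] by (simp add: power2_eq_square algebra_simps)
    then show "2 * B \<le> B\<^sup>2 / L + L"
      using \<open>L > 0\<close> by (simp add: field_simps)
  qed
  finally show ?thesis unfolding B2 .
qed

definition heston_speed :: "(real \<Rightarrow> real \<times> real) \<Rightarrow> real \<Rightarrow> real" where
  "heston_speed \<gamma> t = sqrt (heston_metric (\<gamma> t) (vector_derivative \<gamma> (at t)))"

text \<open>The speed uses the two-sided derivative, which is known to agree with \<open>D\<close>
  only inside the piece. The two end points form a null set, so integrability is inherited from the
  continuous function \<open>h\<close>.\<close>

lemma C1_piece_speed:
  assumes "a < b" and D: "continuous_on {a..b} D"
    and deriv: "\<And>t. t \<in> {a..b} \<Longrightarrow> (\<gamma> has_vector_derivative D t) (at t within {a..b})"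
    and pos: "\<And>t. t \<in> {a..b} \<Longrightarrow> snd (\<gamma> t) > 0"
  shows "heston_speed \<gamma> integrable_on {a..b}"
    and "\<And>t. t \<in> {a<..<b} \<Longrightarrow> (\<gamma> has_vector_derivative D t) (at t)"
    and "\<And>t. t \<in> {a<..<b} \<Longrightarrow> heston_speed \<gamma> t = sqrt (((fst (D t))\<^sup>2 + (snd (D t))\<^sup>2) / snd (\<gamma> t))"
    and "\<And>t. t \<in> {a<..<b} \<Longrightarrow> isCont (heston_speed \<gamma>) t"
proof -
  define h where "h t = sqrt (((fst (D t))\<^sup>2 + (snd (D t))\<^sup>2) / snd (\<gamma> t))" for t
  have \<gamma>: "continuous_on {a..b} \<gamma>"
    using deriv by (meson continuous_on_vector_derivative)
  have h: "continuous_on {a..b} h"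
    unfolding h_def using pos by (intro continuous_intros D \<gamma>) (auto simp: less_imp_neq[symmetric])
  show d: "(\<gamma> has_vector_derivative D t) (at t)" if "t \<in> {a<..<b}" for t
    using deriv[of t] that at_within_Icc_at[of a t b] by auto
  show s: "heston_speed \<gamma> t = sqrt (((fst (D t))\<^sup>2 + (snd (D t))\<^sup>2) / snd (\<gamma> t))" if "t \<in> {a<..<b}" for t
    using vector_derivative_at[OF d[OF that]] by (simp add: heston_speed_def heston_metric_def)
  have "h integrable_on {a..b}" using h by (rule integrable_continuous_interval)
  then show "heston_speed \<gamma> integrable_on {a..b}"
    by (rule integrable_spike_finite[of "{a,b}", rotated 2]) (auto simp: s h_def)
  show "isCont (heston_speed \<gamma>) t" if "t \<in> {a<..<b}" for t
  proof -
    have "isCont h t" using h that by (intro continuous_on_interior[of "{a..b}"]) auto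
    moreover have "eventually (\<lambda>u. heston_speed \<gamma> u = h u) (nhds t)"
      using that s h_def by (intro eventually_nhds_in_open[of "{a<..<b}", THEN eventually_mono]) auto
    ultimately show ?thesis using isCont_cong by metis
  qed
qed

text \<open>By the Riccati equation, \<open>4 * p * x + 4 * v * w \<tau>\<close> solves the
  Hamilton-Jacobi equation of the energy \<open>(x'\<^sup>2 + v'\<^sup>2) / v\<close>. Its increase
  along a curve run at constant speed in unit time is therefore at most the energy, which is then
  the squared length.\<close>

lemma heston_length_lower_bound:
  assumes \<gamma>: "piecewise_C1_curve \<gamma>" "path_image \<gamma> \<subseteq> open_half_plane"
    and ends: "pathstart \<gamma> = (x0, v0)" "pathfinish \<gamma> = (x1, v1)"
    and riccati: "\<And>\<tau>. \<tau> \<in> {0..1} \<Longrightarrow> (w has_real_derivative - (p\<^sup>2 + (w \<tau>)\<^sup>2)) (at \<tau>)"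
  shows "4 * p * (x1 - x0) + 4 * (v1 * w 1 - v0 * w 0) \<le> (heston_length \<gamma>)\<^sup>2"
    and "0 \<le> heston_length \<gamma>"
proof -
  from \<gamma>(1) obtain P where "path \<gamma>" and P: "finite P"
    "\<And>a b. 0 \<le> a \<Longrightarrow> a < b \<Longrightarrow> b \<le> 1 \<Longrightarrow> P \<inter> {a<..<b} = {} \<Longrightarrow>
       \<exists>D. continuous_on {a..b} D \<and> (\<forall>t\<in>{a..b}. (\<gamma> has_vector_derivative D t) (at t within {a..b}))"
    unfolding piecewise_C1_curve_def by blast
  have cont: "continuous_on {0..1} \<gamma>" using \<open>path \<gamma>\<close> by (simp add: path_def)
  have pos: "snd (\<gamma> t) > 0" if "t \<in> {0..1}" for t
    using \<gamma>(2) that by (force simp: path_image_def open_half_plane_def)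
  have int: "heston_speed \<gamma> integrable_on {0..1}"
  proof (rule breakpoint_induct[OF P(1)])
    fix a b :: real assume ab: "0 \<le> a" "a < b" "b \<le> 1" "P \<inter> {a<..<b} = {}"
    then obtain D where "continuous_on {a..b} D"
      "\<forall>t\<in>{a..b}. (\<gamma> has_vector_derivative D t) (at t within {a..b})"
      using P(2) by blast
    then show "heston_speed \<gamma> integrable_on {a..b}"
      using ab pos by (intro C1_piece_speed(1)) auto
  next
    fix c d e :: real
    assume "c < d" "d < e" "heston_speed \<gamma> integrable_on {c..d}" "heston_speed \<gamma> integrable_on {d..e}"
    then show "heston_speed \<gamma> integrable_on {c..e}"
      by (intro Henstock_Kurzweil_Integration.integrable_combine[of c d e]) auto
  qed auto
  have speed0: "heston_speed \<gamma> t \<ge> 0" if "t \<in> {0..1}" for t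
    using pos[OF that] by (simp add: heston_speed_def heston_metric_def)
  define s where "s t = integral {0..t} (heston_speed \<gamma>)" for t
  have len: "heston_length \<gamma> = s 1"
    by (simp add: s_def heston_length_def heston_speed_def [abs_def])
  have s_cont: "continuous_on {0..1} s"
    unfolding s_def by (rule indefinite_integral_continuous_1[OF int])
  have s_mono: "s t \<le> s u" if "0 \<le> t" "t \<le> u" "u \<le> 1" for t u
    unfolding s_def using that speed0
    by (intro integral_subset_le integrable_on_subinterval[OF int]) auto
  have s0: "s 0 = 0" by (simp add: s_def)
  show "0 \<le> heston_length \<gamma>"
    unfolding len using s_mono[of 0 1] s0 by simp
  have bound: "4 * p * (x1 - x0) + 4 * (v1 * w 1 - v0 * w 0) \<le> (heston_length \<gamma> + e)\<^sup>2"
    if "e > 0" for e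
  proof -
    \<comment> \<open>The calibration is evaluated at time \<open>f t / L\<close> (normalised arc length), which replaces a
      reparametrisation of the curve to constant speed; \<open>e\<close> ensures \<open>L > 0\<close>.\<close>
    define L where "L = heston_length \<gamma> + e"
    have L: "L > 0" using \<open>0 \<le> heston_length \<gamma>\<close> \<open>e > 0\<close> by (simp add: L_def)
    define f where "f t = s t + e * t" for t
    define g where "g t = 4 * p * fst (\<gamma> t) + 4 * snd (\<gamma> t) * w (f t / L) - L * f t" for t
    have f01: "f 0 = 0" "f 1 = L" by (simp_all add: f_def s0 L_def len)
    have f_range: "f t / L \<in> {0..1}" if "t \<in> {0..1}" for t
    proof -
      have "0 \<le> f t" using s_mono[of 0 t] s0 that \<open>e > 0\<close> by (simp add: f_def)
      moreover have "f t \<le> L"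
        unfolding f_def L_def len using that \<open>e > 0\<close>
        by (intro add_mono s_mono mult_left_le) auto
      ultimately show ?thesis using L by simp
    qed
    have f_cont: "continuous_on {0..1} f"
      unfolding f_def by (intro continuous_intros s_cont)
    have w_cont: "continuous_on {0..1} w"
      using DERIV_isCont[OF riccati] by (intro continuous_at_imp_continuous_on) blast
    have wf_cont: "continuous_on {0..1} (\<lambda>t. w (f t / L))"
      using f_range L by (intro continuous_on_compose2[OF w_cont] continuous_intros f_cont) auto
    have g_cont: "continuous_on {0..1} g"
      unfolding g_def by (intro continuous_intros cont f_cont wf_cont)
    have "g 1 \<le> g 0"
    proof (rule breakpoint_induct[OF P(1), of 0 1 "\<lambda>a b. g b \<le> g a"])
      fix a b :: real assume ab: "0 \<le> a" "a < b" "b \<le> 1" "P \<inter> {a<..<b} = {}"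
      then obtain D where D: "continuous_on {a..b} D"
        "\<And>t. t\<in>{a..b} \<Longrightarrow> (\<gamma> has_vector_derivative D t) (at t within {a..b})"
        using P(2) by blast
      note piece = C1_piece_speed[OF ab(2) D pos]
      \<comment> \<open>Differentiability of \<open>s\<close> is available only where the speed is
        continuous, that is inside the piece; at its ends continuity of \<open>g\<close>
        suffices.\<close>
      show "g b \<le> g a"
      proof (rule DERIV_nonpos_imp_decreasing_open[OF less_imp_le[OF ab(2)]])
        fix t assume t: "a < t" "t < b"
        then have t01: "t \<in> {0..1}" "t \<in> {a<..<b}" using ab by auto
        have d\<gamma>: "(\<gamma> has_vector_derivative D t) (at t)"
          using piece(2)[of t] t ab by auto
        have dx: "((\<lambda>t. fst (\<gamma> t)) has_real_derivative fst (D t)) (at t)"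
          using bounded_linear.has_vector_derivative[OF bounded_linear_fst d\<gamma>]
          by (simp add: has_real_derivative_iff_has_vector_derivative)
        have dv: "((\<lambda>t. snd (\<gamma> t)) has_real_derivative snd (D t)) (at t)"
          using bounded_linear.has_vector_derivative[OF bounded_linear_snd d\<gamma>]
          by (simp add: has_real_derivative_iff_has_vector_derivative)
        have "isCont (heston_speed \<gamma>) t" using piece(4)[of t] t ab by auto
        then have "(s has_vector_derivative heston_speed \<gamma> t) (at t within {0..1})"
          unfolding s_def using integral_has_vector_derivative_continuous_at[OF int, of t "{}"] t01
          by (auto intro: continuous_at_imp_continuous_at_within)
        then have ds: "(s has_real_derivative heston_speed \<gamma> t) (at t)"
          using t ab at_within_Icc_at[of 0 t 1]
          by (simp add: has_real_derivative_iff_has_vector_derivative)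
        define F where "F = heston_speed \<gamma> t + e"
        have df: "(f has_real_derivative F) (at t)"
          unfolding f_def F_def by (auto intro!: derivative_eq_intros ds)
        have dfL: "((\<lambda>t. f t / L) has_real_derivative F / L) (at t)"
          by (intro DERIV_cdivide df)
        define W where "W = w (f t / L)"
        have dw: "((\<lambda>t. w (f t / L)) has_real_derivative - (p\<^sup>2 + W\<^sup>2) * (F / L)) (at t)"
          unfolding W_def
          by (rule DERIV_chain2[OF riccati[OF f_range[OF t01(1)]] dfL])
        have dg: "(g has_real_derivative
            4 * (p * fst (D t) + W * snd (D t)) - F * (4 * snd (\<gamma> t) * (p\<^sup>2 + W\<^sup>2) / L + L)) (at t)"
          unfolding g_def
          by (rule derivative_eq_intros dx dv dw df refl)+ (use L in \<open>simp add: W_def field_simps\<close>)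
        have "4 * (p * fst (D t) + W * snd (D t)) \<le> F * (4 * snd (\<gamma> t) * (p\<^sup>2 + W\<^sup>2) / L + L)"
          using piece(3)[of t] t ab \<open>e > 0\<close> pos[OF t01(1)] L
          by (intro heston_cauchy_schwarz) (auto simp: F_def)
        with dg show "\<exists>y. (g has_real_derivative y) (at t) \<and> y \<le> 0"
          by (intro exI conjI) auto
      next
        show "continuous_on {a..b} g"
          by (rule continuous_on_subset[OF g_cont]) (use ab in auto)
      qed
    qed auto
    moreover have "g 0 = 4 * p * x0 + 4 * v0 * w 0" "g 1 = 4 * p * x1 + 4 * v1 * w 1 - L\<^sup>2"
      using ends L by (simp_all add: g_def f01 pathstart_def pathfinish_def power2_eq_square)
    ultimately show ?thesis by (simp add: algebra_simps L_def)
  qed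
  have "((\<lambda>e. (heston_length \<gamma> + e)\<^sup>2) \<longlongrightarrow> (heston_length \<gamma> + 0)\<^sup>2) (at_right 0)"
    by (intro tendsto_intros)
  then show "4 * p * (x1 - x0) + 4 * (v1 * w 1 - v0 * w 0) \<le> (heston_length \<gamma>)\<^sup>2"
    using bound by (intro tendsto_lowerbound[where F = "at_right 0"])
      (auto simp: eventually_at_filter)
qed


section \<open>The extremals of the harmonic oscillator\<close>

text \<open>With \<open>p = \<delta> / 2\<close>, \<open>V = v\<^sub>0 + v\<^sub>1\<close> and \<open>R = sqrt (v\<^sub>0 v\<^sub>1)\<close> this is the left-hand side of the equation
  for \<open>\<delta>\<close>.  At \<open>p = 0\<close> the junk value \<open>0 / 0 = 0\<close> happens to be the limit.\<close>

definition heston_angle :: "real \<Rightarrow> real \<Rightarrow> real \<Rightarrow> real" where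
  "heston_angle p V R = (V * (p - sin p * cos p) + 2 * R * (sin p - p * cos p)) / (sin p)\<^sup>2"

text \<open>The solution of \<open>\<rho>'' = - p\<^sup>2 \<rho>\<close> with \<open>\<rho> 0 = r0\<close> and \<open>\<rho> 1 = r1\<close>.\<close>

definition oscillator :: "real \<Rightarrow> real \<Rightarrow> real \<Rightarrow> real \<Rightarrow> real" where
  "oscillator p r0 r1 t = (r0 * sin (p * (1 - t)) + r1 * sin (p * t)) / sin p"

definition oscillator_deriv :: "real \<Rightarrow> real \<Rightarrow> real \<Rightarrow> real \<Rightarrow> real" where
  "oscillator_deriv p r0 r1 t = p * (r1 * cos (p * t) - r0 * cos (p * (1 - t))) / sin p"

lemma has_real_derivative_oscillator [derivative_intros]:
  "(oscillator p r0 r1 has_real_derivative oscillator_deriv p r0 r1 t) (at t within S)"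
  unfolding oscillator_def [abs_def] oscillator_deriv_def divide_inverse
  by (auto intro!: derivative_eq_intros simp: algebra_simps)

lemma has_real_derivative_oscillator_deriv [derivative_intros]:
  "(oscillator_deriv p r0 r1 has_real_derivative - p\<^sup>2 * oscillator p r0 r1 t) (at t within S)"
  unfolding oscillator_def oscillator_deriv_def [abs_def] divide_inverse
  by (auto intro!: derivative_eq_intros simp: algebra_simps power2_eq_square)

lemma sin_nonzero_abs_less_pi:
  fixes p :: real
  assumes "p \<noteq> 0" "\<bar>p\<bar> < pi"
  shows "sin p \<noteq> 0"
  using assms sin_gt_zero[of p] sin_gt_zero[of "- p"] by (cases "p > 0") auto

text \<open>The ratio is even in \<open>p\<close>, and for \<open>0 < p < pi\<close> both arguments
  lie in \<open>(0, pi)\<close>: this is the absence of conjugate points.\<close>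

lemma sin_ratio_pos:
  fixes p t :: real
  assumes "p \<noteq> 0" "\<bar>p\<bar> < pi" "0 < t" "t \<le> 1"
  shows "sin (p * t) / sin p > 0"
proof -
  have *: "sin (q * t) / sin q > 0" if "q > 0" "q < pi" for q
  proof -
    have "q * t < pi" using that assms mult_left_le[of t q] by linarith
    then show ?thesis using that assms by (simp add: sin_gt_zero)
  qed
  show ?thesis using *[of p] *[of "- p"] assms by (cases "p > 0") auto
qed

text \<open>Positivity keeps the logarithmic derivative \<open>w\<close> finite on the whole time
  interval. At \<open>t = 0\<close> the coefficient of \<open>r1\<close> vanishes, hence the case
  split.\<close>

lemma oscillator_pos:
  assumes "p \<noteq> 0" "\<bar>p\<bar> < pi" "r0 > 0" "r1 > 0" "t \<in> {0..1}"
  shows "oscillator p r0 r1 t > 0"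
proof -
  have eq: "oscillator p r0 r1 t = r0 * (sin (p * (1 - t)) / sin p) + r1 * (sin (p * t) / sin p)"
    by (simp add: oscillator_def add_divide_distrib)
  have nn: "sin (p * u) / sin p \<ge> 0" if "0 \<le> u" "u \<le> 1" for u
    using sin_ratio_pos[OF assms(1,2), of u] that by (cases "u = 0") (auto simp: less_imp_le)
  show ?thesis
  proof (cases "t = 0")
    case True
    then show ?thesis using assms sin_nonzero_abs_less_pi[of p] by (simp add: oscillator_def)
  next
    case False
    then show ?thesis
      unfolding eq using assms by (intro add_nonneg_pos mult_nonneg_nonneg mult_pos_pos nn sin_ratio_pos) auto
  qed
qed

text \<open>Conservation of energy: the cross terms combine to \<open>cos (a + b)\<close> with
  \<open>a + b = p\<close>, so \<open>t\<close> drops out.\<close>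

lemma oscillator_energy:
  assumes "sin p \<noteq> 0"
  shows "(oscillator_deriv p r0 r1 t)\<^sup>2 + p\<^sup>2 * (oscillator p r0 r1 t)\<^sup>2
           = p\<^sup>2 / (sin p)\<^sup>2 * (r0\<^sup>2 + r1\<^sup>2 - 2 * (r0 * r1) * cos p)"
proof -
  define a where "a = p * t"
  define b where "b = p * (1 - t)"
  have p: "cos p = cos a * cos b - sin a * sin b"
    using cos_add[of a b] by (simp add: a_def b_def algebra_simps)
  have "(r1 * ca - r0 * cb)\<^sup>2 + (r0 * sb + r1 * sa)\<^sup>2
      = r1\<^sup>2 * (sa\<^sup>2 + ca\<^sup>2) + r0\<^sup>2 * (sb\<^sup>2 + cb\<^sup>2) - 2 * (r0 * r1) * (ca * cb - sa * sb)"
    for sa ca sb cb :: real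
    by (simp add: power2_eq_square algebra_simps)
  from this[of "cos a" "cos b" "sin b" "sin a"]
  have sq: "(r1 * cos a - r0 * cos b)\<^sup>2 + (r0 * sin b + r1 * sin a)\<^sup>2
      = r0\<^sup>2 + r1\<^sup>2 - 2 * (r0 * r1) * (cos a * cos b - sin a * sin b)"
    by simp
  have "(oscillator_deriv p r0 r1 t)\<^sup>2 + p\<^sup>2 * (oscillator p r0 r1 t)\<^sup>2
     = p\<^sup>2 / (sin p)\<^sup>2 * ((r1 * cos a - r0 * cos b)\<^sup>2 + (r0 * sin b + r1 * sin a)\<^sup>2)"
    unfolding oscillator_def oscillator_deriv_def a_def[symmetric] b_def[symmetric]
    by (simp add: power_divide power_mult_distrib add_divide_distrib[symmetric] distrib_left[symmetric])
  then show ?thesis unfolding sq p by simp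
qed

lemma oscillator_riccati:
  assumes "oscillator p r0 r1 t \<noteq> 0"
  shows "((\<lambda>t. oscillator_deriv p r0 r1 t / oscillator p r0 r1 t) has_real_derivative
           - (p\<^sup>2 + (oscillator_deriv p r0 r1 t / oscillator p r0 r1 t)\<^sup>2)) (at t)"
  using DERIV_divide[OF has_real_derivative_oscillator_deriv has_real_derivative_oscillator assms]
  by (rule DERIV_cong) (use assms in \<open>simp add: power2_eq_square divide_simps\<close>)

text \<open>This is where the equation for \<open>\<delta>\<close> enters: when
  \<open>x1 - x0\<close> equals \<open>heston_angle\<close>, the end point terms of the calibration
  add up to the conserved energy, so the lower bound is attained.\<close>

lemma heston_angle_boundary_terms:
  assumes "p \<noteq> 0" "sin p \<noteq> 0"
  shows "p * heston_angle p (r0\<^sup>2 + r1\<^sup>2) (r0 * r1)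
           + (r1 * oscillator_deriv p r0 r1 1 - r0 * oscillator_deriv p r0 r1 0)
         = p\<^sup>2 / (sin p)\<^sup>2 * (r0\<^sup>2 + r1\<^sup>2 - 2 * (r0 * r1) * cos p)"
  using assms by (simp add: heston_angle_def oscillator_deriv_def power2_eq_square field_simps)

section \<open>The distance between two interior points\<close>

lemma heston_dist_interior_eq:
  assumes v: "v0 > 0" "v1 > 0" and p: "p \<noteq> 0" "\<bar>p\<bar> < pi"
    and x: "x1 - x0 = heston_angle p (v0 + v1) (sqrt (v0 * v1))"
  shows "heston_dist_interior (x0, v0) (x1, v1)
           = 2 * p / sin p * sqrt (v0 + v1 - 2 * sqrt (v0 * v1) * cos p)"
proof -
  define r0 r1 where "r0 = sqrt v0" and "r1 = sqrt v1"
  define \<rho> \<rho>' where "\<rho> = oscillator p r0 r1" and "\<rho>' = oscillator_deriv p r0 r1"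
  define E where "E = p\<^sup>2 / (sin p)\<^sup>2 * (r0\<^sup>2 + r1\<^sup>2 - 2 * (r0 * r1) * cos p)"
  have r: "r0 > 0" "r1 > 0" "r0\<^sup>2 = v0" "r1\<^sup>2 = v1" "r0 * r1 = sqrt (v0 * v1)"
    using v by (simp_all add: r0_def r1_def real_sqrt_mult)
  have s: "sin p \<noteq> 0" using p by (rule sin_nonzero_abs_less_pi)
  \<comment> \<open>The sign allows \<open>2 * p / sin p\<close> to be recovered as the root of its
    square.\<close>
  have ratio: "p / sin p > 0"
    using p sin_gt_zero[of p] sin_gt_zero[of "- p"] by (cases "p > 0") (auto simp: divide_neg_neg)
  have \<rho>_pos: "\<rho> t > 0" if "t \<in> {0..1}" for t
    unfolding \<rho>_def using oscillator_pos[OF p r(1,2) that] .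
  have energy: "(\<rho>' t)\<^sup>2 + p\<^sup>2 * (\<rho> t)\<^sup>2 = E" for t
    unfolding \<rho>_def \<rho>'_def E_def by (rule oscillator_energy[OF s])
  have \<rho>01: "\<rho> 0 = r0" "\<rho> 1 = r1" using s by (simp_all add: \<rho>_def oscillator_def)
  have terms: "p * (x1 - x0) + (r1 * \<rho>' 1 - r0 * \<rho>' 0) = E"
    unfolding x using heston_angle_boundary_terms[OF p(1) s, of r0 r1] by (simp add: r \<rho>'_def E_def)
  define d where "d = 2 * p / sin p * sqrt (v0 + v1 - 2 * sqrt (v0 * v1) * cos p)"
  have E0: "E \<ge> 0" using energy[of 0] by (metis add_nonneg_nonneg zero_le_mult_iff zero_le_power2)
  have "d = sqrt (4 * E)"
  proof -
    have "4 * E = (2 * p / sin p)\<^sup>2 * (v0 + v1 - 2 * sqrt (v0 * v1) * cos p)"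
      unfolding E_def r(3-5) by (simp add: power_divide power_mult_distrib)
    then show ?thesis
      unfolding d_def using ratio by (simp only: real_sqrt_mult real_sqrt_abs)
  qed
  then have d: "d\<^sup>2 = 4 * E" "d \<ge> 0" using E0 by auto
  \<comment> \<open>The first component is the explicit integral of
    \<open>2 * p * \<rho>\<^sup>2\<close>: since \<open>(\<rho> * \<rho>')' = \<rho>'\<^sup>2 -
    p\<^sup>2 * \<rho>\<^sup>2\<close> and
    \<open>\<rho>'\<^sup>2 = E - p\<^sup>2 * \<rho>\<^sup>2\<close>, the derivative of
    \<open>E * t - \<rho> * \<rho>'\<close> is \<open>2 * p\<^sup>2 * \<rho>\<^sup>2\<close>. The
    constant \<open>r0 * \<rho>' 0\<close> fixes the value at \<open>t = 0\<close>.\<close>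
  define \<gamma> where "\<gamma> t = (x0 + (E * t - \<rho> t * \<rho>' t + r0 * \<rho>' 0) / p, (\<rho> t)\<^sup>2)" for t
  define D where "D t = (2 * p * (\<rho> t)\<^sup>2, 2 * \<rho> t * \<rho>' t)" for t
  have d\<gamma>: "(\<gamma> has_vector_derivative D t) (at t within S)" for t S
  proof -
    have "((\<lambda>t. x0 + (E * t - \<rho> t * \<rho>' t + r0 * \<rho>' 0) / p) has_real_derivative
             (E - ((\<rho>' t)\<^sup>2 - p\<^sup>2 * (\<rho> t)\<^sup>2)) / p) (at t within S)"
      unfolding \<rho>_def \<rho>'_def
      by (auto intro!: derivative_eq_intros simp: p power2_eq_square algebra_simps
          add_divide_distrib diff_divide_distrib)
    also have "(E - ((\<rho>' t)\<^sup>2 - p\<^sup>2 * (\<rho> t)\<^sup>2)) / p = 2 * p * (\<rho> t)\<^sup>2"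
      unfolding energy[of t, symmetric] using p by (simp add: power2_eq_square field_simps)
    finally have 1: "((\<lambda>t. x0 + (E * t - \<rho> t * \<rho>' t + r0 * \<rho>' 0) / p) has_real_derivative
        2 * p * (\<rho> t)\<^sup>2) (at t within S)" .
    have 2: "((\<lambda>t. (\<rho> t)\<^sup>2) has_real_derivative 2 * \<rho> t * \<rho>' t) (at t within S)"
      unfolding \<rho>_def \<rho>'_def by (auto intro!: derivative_eq_intros simp: power2_eq_square)
    show ?thesis
      unfolding \<gamma>_def D_def
      using 1 2 by (intro has_vector_derivative_Pair) (simp_all add: has_real_derivative_iff_has_vector_derivative)
  qed
  have \<rho>_cont: "continuous_on S \<rho>" "continuous_on S \<rho>'" for S
    unfolding \<rho>_def \<rho>'_def by (meson DERIV_continuous_on has_real_derivative_oscillator has_real_derivative_oscillator_deriv)+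
  have D_cont: "continuous_on S D" for S
    unfolding D_def by (intro continuous_intros \<rho>_cont)
  have geodesic: "piecewise_C1_curve \<gamma>" "path_image \<gamma> \<subseteq> open_half_plane"
    "pathstart \<gamma> = (x0, v0)" "pathfinish \<gamma> = (x1, v1)"
  proof -
    have "path \<gamma>" unfolding path_def by (rule continuous_on_vector_derivative[OF d\<gamma>])
    then show "piecewise_C1_curve \<gamma>"
      unfolding piecewise_C1_curve_def
      by (intro conjI exI[of _ "{}"] allI impI exI[of _ D] ballI D_cont d\<gamma> finite.emptyI)
    show "path_image \<gamma> \<subseteq> open_half_plane"
      using \<rho>_pos by (force simp: path_image_def open_half_plane_def \<gamma>_def)
    show "pathstart \<gamma> = (x0, v0)" by (simp add: pathstart_def \<gamma>_def \<rho>01 r)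
    have "E - r1 * \<rho>' 1 + r0 * \<rho>' 0 = p * (x1 - x0)" using terms by linarith
    then show "pathfinish \<gamma> = (x1, v1)"
      using p by (simp add: pathfinish_def \<gamma>_def \<rho>01 r)
  qed
  have "heston_length \<gamma> = integral {0..1} (\<lambda>t::real. d)"
    unfolding heston_length_def
  proof (rule Henstock_Kurzweil_Integration.integral_cong)
    fix t :: real assume t: "t \<in> {0..1}"
    \<comment> \<open>The squared speed is four times the oscillator energy, so the curve has
      constant speed \<open>d\<close>.\<close>
    have "heston_metric (\<gamma> t) (vector_derivative \<gamma> (at t)) = 4 * ((\<rho>' t)\<^sup>2 + p\<^sup>2 * (\<rho> t)\<^sup>2)"
      using \<rho>_pos[OF t] unfolding vector_derivative_at[OF d\<gamma>]
      by (simp add: heston_metric_def \<gamma>_def D_def power2_eq_square field_simps)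
    then show "sqrt (heston_metric (\<gamma> t) (vector_derivative \<gamma> (at t))) = d"
      using \<open>d = sqrt (4 * E)\<close> by (simp add: energy)
  qed
  then have length: "heston_length \<gamma> = d" by simp
  have minimal: "d \<le> heston_length \<eta>"
    if "piecewise_C1_curve \<eta>" "path_image \<eta> \<subseteq> open_half_plane"
      "pathstart \<eta> = (x0, v0)" "pathfinish \<eta> = (x1, v1)" for \<eta>
  proof -
    define w where "w t = \<rho>' t / \<rho> t" for t
    have "(w has_real_derivative - (p\<^sup>2 + (w t)\<^sup>2)) (at t)" if "t \<in> {0..1}" for t
      unfolding w_def \<rho>_def \<rho>'_def using \<rho>_pos[OF that]
      by (intro oscillator_riccati) (simp add: \<rho>_def)
    note bound = heston_length_lower_bound[OF that this]
    \<comment> \<open>At the end points \<open>v = \<rho>\<^sup>2\<close>, so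
      \<open>v * w = \<rho> * \<rho>'\<close>, and the bound becomes \<open>4 * E\<close>.\<close>
    have "4 * p * (x1 - x0) + 4 * (v1 * w 1 - v0 * w 0) = 4 * (p * (x1 - x0) + (r1 * \<rho>' 1 - r0 * \<rho>' 0))"
      using r(1,2) by (simp add: w_def \<rho>01 r(3,4)[symmetric] power2_eq_square)
    then have "d\<^sup>2 \<le> (heston_length \<eta>)\<^sup>2"
      using bound(1) by (simp add: terms d)
    then show ?thesis using bound(2) by (rule power2_le_imp_le)
  qed
  have "heston_dist_interior (x0, v0) (x1, v1) = d"
    unfolding heston_dist_interior_def
  proof (rule cInf_eq_minimum)
    show "d \<in> {heston_length \<gamma> |\<gamma>. piecewise_C1_curve \<gamma> \<and> path_image \<gamma> \<subseteq> open_half_plane \<and>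
        pathstart \<gamma> = (x0, v0) \<and> pathfinish \<gamma> = (x1, v1)}"
      using geodesic length by blast
  qed (use minimal in blast)
  then show ?thesis by (simp add: d_def)
qed

section \<open>Monotonicity and solvability of the equation for the angle\<close>

lemma mult_cos_less_sin:
  fixes p :: real
  assumes "0 < p" "p < pi"
  shows "p * cos p < sin p"
proof -
  have "(\<lambda>t. sin t - t * cos t) 0 < (\<lambda>t. sin t - t * cos t) p"
  proof (rule DERIV_pos_imp_increasing_open[OF assms(1)])
    fix t assume "0 < t" "t < p"
    then have "t * sin t > 0" using assms by (simp add: sin_gt_zero)
    moreover have "((\<lambda>t. sin t - t * cos t) has_real_derivative t * sin t) (at t)"
      by (auto intro!: derivative_eq_intros)
    ultimately show "\<exists>y. ((\<lambda>t. sin t - t * cos t) has_real_derivative y) (at t) \<and> y > 0" by blast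
  qed (auto intro!: continuous_intros)
  then show ?thesis by simp
qed

text \<open>Together with \<open>mult_cos_less_sin\<close> this gives the signs of the coefficients
  of \<open>V\<close> and \<open>R\<close> in the derivative of \<open>heston_angle\<close>. The
  difference of the two sides has derivative \<open>sin t * (3 * sin t - 2 * (t * cos t))\<close>,
  which is positive by that lemma.\<close>

lemma two_sin_cos_less:
  fixes p :: real
  assumes "0 < p" "p < pi"
  shows "2 * sin p * cos p < p * (1 + (cos p)\<^sup>2)"
proof -
  let ?f = "\<lambda>t::real. t * (1 + (cos t)\<^sup>2) - 2 * sin t * cos t"
  have "?f 0 < ?f p"
  proof (rule DERIV_pos_imp_increasing_open[OF assms(1)])
    fix t assume t: "0 < t" "t < p"
    then have "sin t > 0" "t * cos t < sin t" using assms by (auto intro: sin_gt_zero mult_cos_less_sin)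
    then have "sin t * (3 * sin t - 2 * (t * cos t)) > 0" by simp
    moreover have "(?f has_real_derivative sin t * (3 * sin t - 2 * (t * cos t))) (at t)"
      by (auto intro!: derivative_eq_intros simp: cos_squared_eq algebra_simps power2_eq_square[symmetric])
         (simp add: power2_eq_square algebra_simps, use sin_cos_squared_add[of t] in algebra)
    ultimately show "\<exists>y. (?f has_real_derivative y) (at t) \<and> y > 0" by blast
  qed (auto intro!: continuous_intros)
  then show ?thesis by simp
qed

lemma heston_angle_minus [simp]: "heston_angle (- p) V R = - heston_angle p V R"
  by (simp add: heston_angle_def minus_divide_left algebra_simps del: divide_minus_left)

lemma heston_angle_zero [simp]: "heston_angle 0 V R = 0"
  by (simp add: heston_angle_def)

lemma has_real_derivative_heston_angle:
  assumes "sin p \<noteq> 0"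
  shows "((\<lambda>p. heston_angle p V R) has_real_derivative
     (2 * V * (sin p - p * cos p) + 2 * R * (p * (1 + (cos p)\<^sup>2) - 2 * sin p * cos p)) / (sin p) ^ 3) (at p)"
proof -
  have c: "cos p * cos p = 1 - sin p * sin p"
    using cos_squared_eq[of p] by (simp add: power2_eq_square)
  show ?thesis
    unfolding heston_angle_def
    apply (rule derivative_eq_intros refl)+
     apply (use assms in simp)
    apply (use assms c in \<open>simp add: field_simps power2_eq_square power3_eq_cube\<close>)
    apply (use c in algebra)
    done
qed

lemma heston_angle_less_pos:
  assumes "V > 0" "R \<ge> 0" "0 < p" "p < q" "q < pi"
  shows "heston_angle p V R < heston_angle q V R"
proof (rule DERIV_pos_imp_increasing[OF \<open>p < q\<close>])
  fix t assume t: "p \<le> t" "t \<le> q"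
  then have t0: "0 < t" "t < pi" using assms by auto
  then have s: "sin t > 0" by (rule sin_gt_zero)
  have "0 < 2 * V * (sin t - t * cos t) + 2 * R * (t * (1 + (cos t)\<^sup>2) - 2 * sin t * cos t)" (is "0 < ?N")
    using mult_cos_less_sin[OF t0] two_sin_cos_less[OF t0] assms
    by (intro add_pos_nonneg mult_pos_pos mult_nonneg_nonneg) auto
  then show "\<exists>y. ((\<lambda>p. heston_angle p V R) has_real_derivative y) (at t) \<and> 0 < y"
    using has_real_derivative_heston_angle[of t V R] s by (intro exI[of _ "?N / sin t ^ 3"]) auto
qed

lemma heston_angle_pos:
  assumes "V > 0" "R \<ge> 0" "0 < p" "p < pi"
  shows "heston_angle p V R > 0"
proof -
  have s: "sin p > 0" using assms by (simp add: sin_gt_zero)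
  have "cos p < 1" using cos_monotone_0_pi[of 0 p] assms by simp
  then have "sin p * cos p < p" using mult_strict_left_mono[of "cos p" 1 "sin p"] s sin_x_le_x[of p] assms by linarith
  then show ?thesis unfolding heston_angle_def using s assms mult_cos_less_sin[of p]
    by (intro divide_pos_pos add_pos_nonneg mult_pos_pos mult_nonneg_nonneg) auto
qed

text \<open>The derivative formula breaks down at \<open>p = 0\<close>. Oddness carries monotonicity
  to negative angles, and the two halves are joined by the sign of the values.\<close>

lemma strict_mono_on_heston_angle:
  assumes "V > 0" "R \<ge> 0"
  shows "strict_mono_on {-pi<..<pi} (\<lambda>p. heston_angle p V R)"
proof (rule strict_mono_onI)
  fix p q assume pq: "p \<in> {-pi<..<pi}" "q \<in> {-pi<..<pi}" "p < q"
  have pos: "heston_angle t V R > 0" if "0 < t" "t < pi" for t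
    using heston_angle_pos assms that by blast
  have neg: "heston_angle t V R < 0" if "t < 0" "- pi < t" for t
    using pos[of "- t"] that by simp
  consider "0 < p" | "q < 0" | "p \<le> 0" "0 \<le> q" by linarith
  then show "heston_angle p V R < heston_angle q V R"
  proof cases
    case 1
    then show ?thesis using heston_angle_less_pos assms pq by auto
  next
    case 2
    then show ?thesis using heston_angle_less_pos[OF assms, of "- q" "- p"] pq by auto
  next
    case 3
    then show ?thesis using pos[of q] neg[of p] pq
      by (cases "p = 0"; cases "q = 0") auto
  qed
qed

lemma heston_angle_solution_exists:
  assumes "V > 0" "R \<ge> 0"
  shows "\<exists>p. \<bar>p\<bar> < pi \<and> heston_angle p V R = X"
proof -
  have pos: "\<exists>p. \<bar>p\<bar> < pi \<and> heston_angle p V R = Y" if "Y > 0" for Y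
  proof -
    \<comment> \<open>The numerator is of third order at \<open>0\<close>, the denominator of second
      order.\<close>
    have "((\<lambda>p. heston_angle p V R) \<longlongrightarrow> 0) (at_right 0)"
      unfolding heston_angle_def by real_asymp
    then have "eventually (\<lambda>p. heston_angle p V R < Y) (at_right 0)"
      using that by (auto dest: order_tendstoD)
    moreover have "eventually (\<lambda>p::real. 0 < p \<and> p < pi / 2) (at_right 0)"
      by (auto simp: eventually_at_right_less eventually_at_right_field intro!: exI[of _ "pi/2"])
    ultimately obtain a where a: "0 < a" "a < pi / 2" "heston_angle a V R < Y"
      using eventually_happens'[OF trivial_limit_at_right_real eventually_conj] by blast
    \<comment> \<open>A minorant on \<open>(pi / 2, pi)\<close>: there \<open>cos p \<le> 0\<close>
      gives \<open>p - sin p * cos p \<ge> pi / 2\<close>, and the \<open>R\<close> term is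
      nonnegative. Blow-up at \<open>pi\<close> thus needs only \<open>V > 0\<close>, which covers
      \<open>R = 0\<close>.\<close>
    have "filterlim (\<lambda>p. V * (pi / 2) / (sin p)\<^sup>2) at_top (at_left pi)"
      using \<open>V > 0\<close> by real_asymp
    then have "eventually (\<lambda>p. V * (pi / 2) / (sin p)\<^sup>2 > Y) (at_left pi)"
      by (auto simp: filterlim_at_top_dense)
    moreover have "eventually (\<lambda>p::real. pi / 2 < p \<and> p < pi) (at_left pi)"
      by (auto simp: eventually_at_left_field intro!: exI[of _ "pi/2"])
    ultimately obtain b where b: "pi / 2 < b" "b < pi" "Y < V * (pi / 2) / (sin b)\<^sup>2"
      using eventually_happens'[OF trivial_limit_at_left_real eventually_conj] by blast
    have "V * (pi / 2) / (sin b)\<^sup>2 \<le> heston_angle b V R"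
      unfolding heston_angle_def
    proof (rule divide_right_mono)
      have "cos b \<le> 0" using b cos_monotone_0_pi_le[of "pi/2" b] by simp
      moreover have "sin b > 0" using b by (intro sin_gt_zero) auto
      ultimately have "sin b * cos b \<le> 0" by (simp add: mult_nonneg_nonpos)
      then have "V * (pi / 2) \<le> V * (b - sin b * cos b)" using b \<open>V > 0\<close> by simp
      moreover have "2 * R * (sin b - b * cos b) \<ge> 0"
        using mult_cos_less_sin[of b] b assms by simp
      ultimately show "V * (pi / 2) \<le> V * (b - sin b * cos b) + 2 * R * (sin b - b * cos b)" by simp
    qed simp
    then have b': "Y < heston_angle b V R" using b by simp
    have "\<exists>p\<ge>a. p \<le> b \<and> heston_angle p V R = Y"
    proof (rule IVT)
      show "\<forall>t. a \<le> t \<and> t \<le> b \<longrightarrow> isCont (\<lambda>p. heston_angle p V R) t"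
        using a b sin_nonzero_abs_less_pi by (auto intro!: DERIV_isCont[OF has_real_derivative_heston_angle])
    qed (use a b b' in auto)
    then obtain p where p: "a \<le> p" "p \<le> b" "heston_angle p V R = Y" by blast
    then have "\<bar>p\<bar> < pi" using a b by linarith
    with p show ?thesis by blast
  qed
  show ?thesis
  proof (cases X "0::real" rule: linorder_cases)
    case less
    then obtain p where "\<bar>p\<bar> < pi" "heston_angle p V R = - X" using pos[of "- X"] by auto
    then show ?thesis by (intro exI[of _ "- p"]) auto
  next
    case equal
    then show ?thesis by (intro exI[of _ 0]) auto
  qed (use pos in auto)
qed

text \<open>A strict inequality between the values at \<open>b\<close> and at \<open>p\<close>
  persists for nearby parameters; monotonicity in the angle turns it into an inequality between
  \<open>b\<close> and \<open>q z\<close>.\<close>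

lemma heston_angle_solution_tendsto:
  assumes V: "(V' \<longlongrightarrow> V) F" and R: "(R' \<longlongrightarrow> R) F"
    and "V > 0" "R \<ge> 0" "\<bar>p\<bar> < pi"
    and lim: "((\<lambda>z. heston_angle (q z) (V' z) (R' z)) \<longlongrightarrow> heston_angle p V R) F"
    and q: "eventually (\<lambda>z. \<bar>q z\<bar> < pi \<and> V' z > 0 \<and> R' z \<ge> 0) F"
  shows "(q \<longlongrightarrow> p) F"
proof -
  have cont: "((\<lambda>z. heston_angle a (V' z) (R' z)) \<longlongrightarrow> heston_angle a V R) F" for a
    unfolding heston_angle_def divide_inverse by (intro tendsto_intros V R)
  have mono: "heston_angle a V R < heston_angle b V R \<longleftrightarrow> a < b"
    if "\<bar>a\<bar> < pi" "\<bar>b\<bar> < pi" "V > 0" "R \<ge> 0" for a b V R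
    using strict_mono_on_less[OF strict_mono_on_heston_angle[OF that(3,4)], of a b] that by (simp add: abs_less_iff)
  show ?thesis
  proof (rule order_tendstoI)
    fix a assume "a < p"
    \<comment> \<open>Clipping \<open>a\<close> at \<open>- pi\<close> keeps the midpoint inside the
      interval of monotonicity.\<close>
    define b where "b = (max a (- pi) + p) / 2"
    have b: "a < b" "\<bar>b\<bar> < pi" "b < p" using \<open>a < p\<close> \<open>\<bar>p\<bar> < pi\<close> by (auto simp: b_def max_def field_simps)
    then have "heston_angle b V R < heston_angle p V R" using mono assms by blast
    from order_tendstoD(1)[OF tendsto_diff[OF lim cont[of b]], of 0] this
    have "eventually (\<lambda>z. 0 < heston_angle (q z) (V' z) (R' z) - heston_angle b (V' z) (R' z)) F" by simp
    with q show "eventually (\<lambda>z. a < q z) F"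
    proof eventually_elim
      case (elim z)
      then have "b < q z" using mono[of b "q z" "V' z" "R' z"] b by auto
      then show ?case using b by simp
    qed
  next
    fix a assume "p < a"
    define b where "b = (min a pi + p) / 2"
    have b: "b < a" "\<bar>b\<bar> < pi" "p < b" using \<open>p < a\<close> \<open>\<bar>p\<bar> < pi\<close> by (auto simp: b_def min_def field_simps)
    then have "heston_angle p V R < heston_angle b V R" using mono assms by blast
    from order_tendstoD(1)[OF tendsto_diff[OF cont[of b] lim], of 0] this
    have "eventually (\<lambda>z. 0 < heston_angle b (V' z) (R' z) - heston_angle (q z) (V' z) (R' z)) F" by simp
    with q show "eventually (\<lambda>z. q z < a) F"
    proof eventually_elim
      case (elim z)
      then have "q z < b" using mono[of "q z" b "V' z" "R' z"] b by auto
      then show ?case using b by simp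
    qed
  qed
qed

section \<open>Extension to the boundary\<close>

text \<open>Vertical shifts \<open>(x, v + e)\<close> approach each point from inside. This makes
  the filter in the definition of \<open>heston_dist\<close> nontrivial, so that its limit is
  unique.\<close>

lemma Pair_in_closure_open_half_planes:
  assumes "p \<in> closed_half_plane" "q \<in> closed_half_plane"
  shows "(p, q) \<in> closure (open_half_plane \<times> open_half_plane)"
proof -
  have "z \<in> closure open_half_plane" if "z \<in> closed_half_plane" for z
  proof -
    have "((\<lambda>e. (fst z, snd z + e)) \<longlongrightarrow> (fst z, snd z + 0)) (at_right (0::real))"
      by (intro tendsto_intros)
    moreover have "eventually (\<lambda>e. (fst z, snd z + e) \<in> closure open_half_plane) (at_right 0)"
      using that closure_subset
      by (auto simp: eventually_at_filter closed_half_plane_def open_half_plane_def case_prod_unfold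
          intro!: always_eventually set_mp[OF closure_subset])
    ultimately have "(fst z, snd z + 0) \<in> closure open_half_plane"
      by (intro Lim_in_closed_set[OF closed_closure]) auto
    then show ?thesis by simp
  qed
  then show ?thesis using assms by (simp add: closure_Times)
qed

lemma heston_dist_eq:
  assumes closed: "(x0, v0) \<in> closed_half_plane" "(x1, v1) \<in> closed_half_plane"
    and "v0 > 0 \<or> v1 > 0" and p: "p \<noteq> 0" "\<bar>p\<bar> < pi"
    and x: "x1 - x0 = heston_angle p (v0 + v1) (sqrt (v0 * v1))"
  shows "heston_dist (x0, v0) (x1, v1) = 2 * p / sin p * sqrt (v0 + v1 - 2 * sqrt (v0 * v1) * cos p)"
proof (cases "v0 > 0 \<and> v1 > 0")
  case True
  then show ?thesis
    using heston_dist_interior_eq[OF _ _ p x] by (simp add: heston_dist_def open_half_plane_def)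
next
  case False
  have v: "v0 \<ge> 0" "v1 \<ge> 0" using closed by (auto simp: closed_half_plane_def)
  let ?S = "open_half_plane \<times> open_half_plane"
  define F where "F = at ((x0, v0), (x1, v1)) within ?S"
  define V R where "V = (\<lambda>z::(real \<times> real) \<times> (real \<times> real). snd (fst z) + snd (snd z))"
    and "R = (\<lambda>z::(real \<times> real) \<times> (real \<times> real). sqrt (snd (fst z) * snd (snd z)))"
  have notin: "((x0, v0), (x1, v1)) \<notin> ?S" using False by (auto simp: open_half_plane_def)
  \<comment> \<open>A point of the closure lying outside the set is a limit point of it.\<close>
  have "F \<noteq> bot"
    unfolding F_def trivial_limit_within
    using Pair_in_closure_open_half_planes[OF closed] notin by (auto simp: closure_def)
  have S: "eventually (\<lambda>z. z \<in> ?S) F" unfolding F_def by (simp add: eventually_at_filter)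
  have id: "((\<lambda>z. z) \<longlongrightarrow> ((x0, v0), (x1, v1))) F" unfolding F_def by (rule tendsto_ident_at)
  have lim: "(V \<longlongrightarrow> v0 + v1) F" "(R \<longlongrightarrow> sqrt (v0 * v1)) F"
    "((\<lambda>z. fst (snd z) - fst (fst z)) \<longlongrightarrow> x1 - x0) F"
    unfolding V_def R_def by (auto intro!: tendsto_eq_intros id)
  have "\<forall>z\<in>?S. \<exists>q. \<bar>q\<bar> < pi \<and> heston_angle q (V z) (R z) = fst (snd z) - fst (fst z)"
    by (auto intro!: heston_angle_solution_exists simp: V_def R_def open_half_plane_def)
  then obtain q where q: "\<And>z. z \<in> ?S \<Longrightarrow> \<bar>q z\<bar> < pi \<and> heston_angle (q z) (V z) (R z) = fst (snd z) - fst (fst z)"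
    by metis
  have q_lim: "(q \<longlongrightarrow> p) F"
  proof (rule heston_angle_solution_tendsto[OF lim(1,2)])
    show "((\<lambda>z. heston_angle (q z) (V z) (R z)) \<longlongrightarrow> heston_angle p (v0 + v1) (sqrt (v0 * v1))) F"
      using lim(3) unfolding x
      by (rule Lim_transform_eventually) (use S q in \<open>auto elim!: eventually_mono\<close>)
    show "eventually (\<lambda>z. \<bar>q z\<bar> < pi \<and> V z > 0 \<and> R z \<ge> 0) F"
      using S by eventually_elim (use q in \<open>auto simp: V_def R_def open_half_plane_def\<close>)
  qed (use assms v in auto)
  have "((\<lambda>z. 2 * q z / sin (q z) * sqrt (V z - 2 * R z * cos (q z))) \<longlongrightarrow>
      2 * p / sin p * sqrt (v0 + v1 - 2 * sqrt (v0 * v1) * cos p)) F"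
    using sin_nonzero_abs_less_pi[OF p] by (intro tendsto_intros q_lim lim)
  \<comment> \<open>The interior formula requires a nonzero angle; this holds near the limit because
    \<open>p \<noteq> 0\<close>.\<close>
  moreover have "eventually (\<lambda>z. q z \<noteq> 0) F" using tendsto_imp_eventually_ne[OF q_lim p(1)] .
  with S have "eventually (\<lambda>z. 2 * q z / sin (q z) * sqrt (V z - 2 * R z * cos (q z))
      = (\<lambda>(p', q'). heston_dist_interior p' q') z) F"
  proof eventually_elim
    case (elim z)
    then show ?case
      using q[of z] heston_dist_interior_eq[of "snd (fst z)" "snd (snd z)" "q z" "fst (snd z)" "fst (fst z)"]
      by (auto simp: V_def R_def open_half_plane_def)
  qed
  ultimately have "((\<lambda>(p', q'). heston_dist_interior p' q') \<longlongrightarrow>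
      2 * p / sin p * sqrt (v0 + v1 - 2 * sqrt (v0 * v1) * cos p)) F"
    by (rule Lim_transform_eventually)
  from tendsto_Lim[OF \<open>F \<noteq> bot\<close> this] show ?thesis
    using notin by (auto simp: heston_dist_def F_def)
qed

section \<open>Return to the stated equation by half angles\<close>

lemma delta_lhs_eq_heston_angle:
  "delta_lhs v0 v1 \<delta> = heston_angle (\<delta> / 2) (v0 + v1) (sqrt (v0 * v1))"
proof (cases "\<delta> = 0")
  case False
  have "sin \<delta> = 2 * sin (\<delta> / 2) * cos (\<delta> / 2)" using sin_double[of "\<delta> / 2"] by simp
  then have "(v1 + v0) * (\<delta> - sin \<delta>) - 2 * sqrt (v1 * v0) * (\<delta> * cos (\<delta> / 2) - 2 * sin (\<delta> / 2))
     = 2 * ((v0 + v1) * (\<delta> / 2 - sin (\<delta> / 2) * cos (\<delta> / 2))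
        + 2 * sqrt (v0 * v1) * (sin (\<delta> / 2) - \<delta> / 2 * cos (\<delta> / 2)))"
    by (simp add: mult.commute[of v1 v0] algebra_simps)
  then show ?thesis using False unfolding delta_lhs_def heston_angle_def
    by (simp only: if_False mult_divide_mult_cancel_left_if) simp
qed (simp add: delta_lhs_def)

theorem theorem3:
  fixes x0 v0 x1 v1 :: real
  assumes "(x0, v0) \<in> closed_half_plane"
    and "(x1, v1) \<in> closed_half_plane"
    and "x0 \<noteq> x1"
    and "v0 > 0 \<or> v1 > 0"
  shows "(\<exists>!\<delta>. - 2 * pi < \<delta> \<and> \<delta> < 2 * pi \<and> delta_lhs v0 v1 \<delta> = x1 - x0) \<and>
    (\<forall>\<delta>. - 2 * pi < \<delta> \<and> \<delta> < 2 * pi \<and> delta_lhs v0 v1 \<delta> = x1 - x0 \<longrightarrow>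
       heston_dist (x0, v0) (x1, v1) =
         \<delta> / sin (\<delta> / 2) * sqrt (v1 + v0 - 2 * sqrt (v1 * v0) * cos (\<delta> / 2)))"
proof
  let ?V = "v0 + v1" and ?R = "sqrt (v0 * v1)"
  have V: "?V > 0" "?R \<ge> 0" using assms by (auto simp: closed_half_plane_def)
  show "\<exists>!\<delta>. - 2 * pi < \<delta> \<and> \<delta> < 2 * pi \<and> delta_lhs v0 v1 \<delta> = x1 - x0"
  proof (rule ex_ex1I)
    obtain p where "\<bar>p\<bar> < pi" "heston_angle p ?V ?R = x1 - x0"
      using heston_angle_solution_exists[OF V] by blast
    then show "\<exists>\<delta>. - 2 * pi < \<delta> \<and> \<delta> < 2 * pi \<and> delta_lhs v0 v1 \<delta> = x1 - x0"
      by (intro exI[of _ "2 * p"]) (auto simp: delta_lhs_eq_heston_angle)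
  next
    fix \<delta> \<epsilon>
    assume \<delta>: "- 2 * pi < \<delta> \<and> \<delta> < 2 * pi \<and> delta_lhs v0 v1 \<delta> = x1 - x0"
      and \<epsilon>: "- 2 * pi < \<epsilon> \<and> \<epsilon> < 2 * pi \<and> delta_lhs v0 v1 \<epsilon> = x1 - x0"
    have "inj_on (\<lambda>p. heston_angle p ?V ?R) {-pi<..<pi}"
      using strict_mono_on_heston_angle[OF V] by (rule strict_mono_on_imp_inj_on)
    moreover have "heston_angle (\<delta> / 2) ?V ?R = heston_angle (\<epsilon> / 2) ?V ?R"
      using \<delta> \<epsilon> by (simp only: delta_lhs_eq_heston_angle)
    ultimately have "\<delta> / 2 = \<epsilon> / 2"
      by (rule inj_onD) (use \<delta> \<epsilon> in simp_all)
    then show "\<delta> = \<epsilon>" by simp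
  qed
  show "\<forall>\<delta>. - 2 * pi < \<delta> \<and> \<delta> < 2 * pi \<and> delta_lhs v0 v1 \<delta> = x1 - x0 \<longrightarrow>
       heston_dist (x0, v0) (x1, v1) =
         \<delta> / sin (\<delta> / 2) * sqrt (v1 + v0 - 2 * sqrt (v1 * v0) * cos (\<delta> / 2))"
  proof (intro allI impI)
    fix \<delta> assume \<delta>: "- 2 * pi < \<delta> \<and> \<delta> < 2 * pi \<and> delta_lhs v0 v1 \<delta> = x1 - x0"
    \<comment> \<open>The value \<open>0\<close> assigned at \<open>\<delta> = 0\<close> would force
      \<open>x1 = x0\<close>.\<close>
    then have "\<delta> / 2 \<noteq> 0" using \<open>x0 \<noteq> x1\<close> by (auto simp: delta_lhs_def)
    then show "heston_dist (x0, v0) (x1, v1) =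
         \<delta> / sin (\<delta> / 2) * sqrt (v1 + v0 - 2 * sqrt (v1 * v0) * cos (\<delta> / 2))"
      using heston_dist_eq[OF assms(1,2,4), of "\<delta> / 2"] \<delta>
      by (simp add: delta_lhs_eq_heston_angle add.commute[of v1] mult.commute[of v1] abs_less_iff)
  qed
qed

end
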